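(* Let $D$ be the finite set of participants of the exchange of a central counterparty (CCP) before the instant default of a clearing member $d\in D$, and let $D'$ be the finite set of participants after the default, which includes the CCP itself as a participant denoted $c$. Assume $(R_i,P)\sim\mathcal{N}_{m+1}(\mu_i,\Gamma_i)$ for $i\in D\cup D'$, that $\Gamma=\mathbb{C}\mathrm{ov}(P)$ is invertible, and that each $i\in D\cup D'$ uses the entropic risk measure $\rho_i(L)=\frac1{\varrho_i}\ln(\mathbb{E}[\exp(\varrho_iL)])$ with $\varrho_i>0$. When the CCP hedges the defaulter's position $\mathbf{q}_d$ on its own exchange, $$\mathrm{LC}_D=-\mathbf{q}_d^\top(\mathbf{p}^D-\mathbf{p}'^D),$$ $$\mathrm{MC}_D=\sum_{i\in D'}\varrho_i(\Delta\mathbf{q}_i)^\top\Big[\mathrm{cov}_i+\Gamma\big(\mathbf{q}_i+\tfrac12\Delta\mathbf{q}_i\big)\Big]+\Big(\frac{\varrho_c\mathbb{V}\mathrm{ar}(R_c)}{2}-\mathbb{E}[R_c]\Big).$$ In the absence of new participants other than the CCP, i.e. if $D'=(D\setminus\{d\})\cup\{c\}$, $$\mathrm{MC}_D=\frac{\varrho^2(\varrho'-\varrho_c)}{2\varrho_c^2}\,\mathrm{cov}^\top\Gamma^{-1}\mathrm{cov}+\frac{\varrho'}{2}\mathbf{q}_d^\top\Gamma\mathbf{q}_d-\frac{\varrho'\varrho}{\varrho_c}\mathbf{q}_d^\top\mathrm{cov}.$$ Here $\varrho=\big(\sum_{i\in D}\frac1{\varrho_i}\big)^{-1}$, $\varrho'=\big(\sum_{i\in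 D'}\frac1{\varrho_i}\big)^{-1}$ and $\mathrm{cov}=\sum_{i\in D}\mathrm{cov}_i$.
   Context: Random variables live on a probability space; $R_i$ is real valued (receivable of participant $i$), $P$ takes values in $\mathbb{R}^m$, $m\ge1$; $\mathrm{cov}_i=(\mathbb{C}\mathrm{ov}(R_i,P_1),\dots,\mathbb{C}\mathrm{ov}(R_i,P_m))\in\mathbb{R}^m$. $\mathcal{N}_n(\mu,\Gamma)$ is the $n$-variate Gaussian law with mean $\mu$ and covariance $\Gamma$. The set $D'$ consists of the survivors $D\setminus\{d\}$, the CCP $c\notin D$, and possibly further new participants; $d\notin D'$. Receivables, $P$ and risk measures are unaffected by the default, except that the CCP has zero receivable before the default and receivable $R_c=\mathbf{q}_d^\top(P-\mathbf{p}^D)$ after it. Pre-default equilibrium $((\mathbf{q}_i)_{i\in D},\mathbf{p}^D)$: the Radner equilibrium on $D$, i.e. for every $i\in D$ and $q_i\in\mathbb{R}^m$, $\rho_i(-R_i+\mathbf{q}_i^\top(\mathbf{p}^D-P))\le\rho_i(-R_i+q_i^\top(\mathbf{p}^D-P))$, and $\sum_{i\in D}\mathbf{q}_i=0$. Set $\mathbf{q}_i=0$ for $i\in D'\setminus D$. Post-default equilibrium $((\mathbf{q}'_i)_{i\in D'},\mathbf{p}'^D)$ when the CCP hedges $\mathbf{q}_d$ on its own exchange: for every $i\in D'$ and $q_i\in\mathbb{R}^m$, $\rho_i(-R_i+(\mathbf{q}'_i)^\top(\mathbf{p}'^D-P))\le\rho_i(-R_i+q_i^\top(\mathbf{p}'^D-P))$,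 and $\sum_{i\in D'}\Delta\mathbf{q}_i=0$, where $\Delta\mathbf{q}_i=\mathbf{q}'_i-\mathbf{q}_i$ (equivalently $\sum_{i\in D'}\mathbf{q}'_i=-\mathbf{q}_d$). (Under the stated assumptions both equilibria exist and are unique.) Liquidity cost and market cost: $$\mathrm{LC}_D=\sum_{i\in D'}(\mathbf{q}'_i)^\top(\mathbf{p}^D-\mathbf{p}'^D),\qquad \mathrm{MC}_D=\mathrm{LC}_D+\sum_{i\in D'}\Delta\boldsymbol\rho_i,$$ $$\Delta\boldsymbol\rho_i=\rho_i\big(-R_i+(\mathbf{q}'_i)^\top(\mathbf{p}'^D-P)\big)-\rho_i\big(-\mathbf{1}_{i\ne c}R_i+\mathbf{q}_i^\top(\mathbf{p}^D-P)\big),\quad i\in D'.$$ *)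

theory Defs
  imports "HOL-Probability.Probability"
begin

text \<open>
  The Gaussian law with mean \<open>mu\<close> and variance \<open>v \<ge> 0\<close>. The degenerate case is
  the Dirac mass at \<open>mu\<close>; it has to be treated separately because the library's
  \<open>normal_density mu 0\<close> is identically \<open>0\<close>.
\<close>

definition gaussian_measure :: "real \<Rightarrow> real \<Rightarrow> real measure" where
  "gaussian_measure mu v =
     (if v = 0 then return borel mu else density lborel (normal_density mu (sqrt v)))"

text \<open>
  \<open>X \<sim> N\<^sub>n(mu, S)\<close>: \<open>S\<close> is symmetric positive semidefinite and every linear functional
  \<open>t \<bullet> X\<close> has the univariate law \<open>N(t \<bullet> mu, t \<bullet> S t)\<close>. Singular \<open>S\<close> must be
  allowed, since the receivable that the CCP acquires at the default is an affine
  function of \<open>P\<close>.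
\<close>

definition has_gaussian_law ::
    "'a measure \<Rightarrow> ('a \<Rightarrow> real^'n) \<Rightarrow> real^'n \<Rightarrow> real^'n^'n \<Rightarrow> bool" where
  "has_gaussian_law M X mu S \<longleftrightarrow>
     X \<in> borel_measurable M \<and>
     transpose S = S \<and> (\<forall>t. 0 \<le> t \<bullet> (S *v t)) \<and>
     (\<forall>t. distr M borel (\<lambda>\<omega>. t \<bullet> X \<omega>) = gaussian_measure (t \<bullet> mu) (t \<bullet> (S *v t)))"

text \<open>
  The vector \<open>(r, p\<^sub>1, \<dots>, p\<^sub>m)\<close> of dimension \<open>m + 1\<close>, with \<open>None\<close> indexing the
  additional coordinate \<open>r\<close>.
\<close>

definition vec_cons :: "real \<Rightarrow> real^'m \<Rightarrow> real^('m option)" where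
  "vec_cons r p = (\<chi> k. case k of None \<Rightarrow> r | Some j \<Rightarrow> p $ j)"

definition covariance :: "'a measure \<Rightarrow> ('a \<Rightarrow> real) \<Rightarrow> ('a \<Rightarrow> real) \<Rightarrow> real" where
  "covariance M X Y =
     prob_space.expectation M
       (\<lambda>\<omega>. (X \<omega> - prob_space.expectation M X) * (Y \<omega> - prob_space.expectation M Y))"

definition cov_vector :: "'a measure \<Rightarrow> ('a \<Rightarrow> real) \<Rightarrow> ('a \<Rightarrow> real^'m) \<Rightarrow> real^'m" where
  "cov_vector M X P = (\<chi> j. covariance M X (\<lambda>\<omega>. P \<omega> $ j))"

definition cov_matrix :: "'a measure \<Rightarrow> ('a \<Rightarrow> real^'m) \<Rightarrow> real^'m^'m" where
  "cov_matrix M P = (\<chi> j k. covariance M (\<lambda>\<omega>. P \<omega> $ j) (\<lambda>\<omega>. P \<omega> $ k))"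

text \<open>
  Positive values of the argument \<open>L\<close> are losses. The value is meaningful only when
  \<open>exp (r * L)\<close> is integrable, which holds for every Gaussian \<open>L\<close>.
\<close>

definition entropic_risk :: "'a measure \<Rightarrow> real \<Rightarrow> ('a \<Rightarrow> real) \<Rightarrow> real" where
  "entropic_risk M r L = 1 / r * ln (prob_space.expectation M (\<lambda>\<omega>. exp (r * L \<omega>)))"

definition optimal_position ::
    "(('a \<Rightarrow> real) \<Rightarrow> real) \<Rightarrow> ('a \<Rightarrow> real) \<Rightarrow> ('a \<Rightarrow> real^'m) \<Rightarrow> real^'m \<Rightarrow> real^'m \<Rightarrow> bool" where
  "optimal_position rho R P p q \<longleftrightarrow>
     (\<forall>x. rho (\<lambda>\<omega>. - R \<omega> + q \<bullet> (p - P \<omega>)) \<le> rho (\<lambda>\<omega>. - R \<omega> + x \<bullet> (p - P \<omega>)))"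

definition radner_equilibrium ::
    "'i set \<Rightarrow> ('i \<Rightarrow> ('a \<Rightarrow> real) \<Rightarrow> real) \<Rightarrow> ('i \<Rightarrow> 'a \<Rightarrow> real) \<Rightarrow> ('a \<Rightarrow> real^'m) \<Rightarrow>
     ('i \<Rightarrow> real^'m) \<Rightarrow> real^'m \<Rightarrow> bool" where
  "radner_equilibrium D rho R P q p \<longleftrightarrow>
     (\<forall>i\<in>D. optimal_position (rho i) (R i) P p (q i)) \<and> (\<Sum>i\<in>D. q i) = 0"

text \<open>
  Equilibrium \<open>(q', p')\<close> on the post-default exchange \<open>D'\<close>, starting from the positions
  \<open>q\<close>: it is the position changes that have to clear.
\<close>

definition post_default_equilibrium ::
    "'i set \<Rightarrow> ('i \<Rightarrow> ('a \<Rightarrow> real) \<Rightarrow> real) \<Rightarrow> ('i \<Rightarrow> 'a \<Rightarrow> real) \<Rightarrow> ('a \<Rightarrow> real^'m) \<Rightarrow>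
     ('i \<Rightarrow> real^'m) \<Rightarrow> ('i \<Rightarrow> real^'m) \<Rightarrow> real^'m \<Rightarrow> bool" where
  "post_default_equilibrium D' rho R P q q' p' \<longleftrightarrow>
     (\<forall>i\<in>D'. optimal_position (rho i) (R i) P p' (q' i)) \<and> (\<Sum>i\<in>D'. q' i - q i) = 0"

definition liquidity_cost ::
    "'i set \<Rightarrow> ('i \<Rightarrow> real^'m) \<Rightarrow> real^'m \<Rightarrow> real^'m \<Rightarrow> real" where
  "liquidity_cost D' q' p p' = (\<Sum>i\<in>D'. q' i \<bullet> (p - p'))"

text \<open>
  \<open>R c\<close> is the receivable of the CCP after the default; before the default its receivable
  is \<open>0\<close>, whence the factor \<open>of_bool (i \<noteq> c)\<close>.
\<close>

definition risk_change ::
    "'i \<Rightarrow> ('i \<Rightarrow> ('a \<Rightarrow> real) \<Rightarrow> real) \<Rightarrow> ('i \<Rightarrow> 'a \<Rightarrow> real) \<Rightarrow> ('a \<Rightarrow> real^'m) \<Rightarrow>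
     ('i \<Rightarrow> real^'m) \<Rightarrow> real^'m \<Rightarrow> ('i \<Rightarrow> real^'m) \<Rightarrow> real^'m \<Rightarrow> 'i \<Rightarrow> real" where
  "risk_change c rho R P q p q' p' i =
     rho i (\<lambda>\<omega>. - R i \<omega> + q' i \<bullet> (p' - P \<omega>)) -
     rho i (\<lambda>\<omega>. - (of_bool (i \<noteq> c) * R i \<omega>) + q i \<bullet> (p - P \<omega>))"

definition market_cost ::
    "'i set \<Rightarrow> 'i \<Rightarrow> ('i \<Rightarrow> ('a \<Rightarrow> real) \<Rightarrow> real) \<Rightarrow> ('i \<Rightarrow> 'a \<Rightarrow> real) \<Rightarrow> ('a \<Rightarrow> real^'m) \<Rightarrow>
     ('i \<Rightarrow> real^'m) \<Rightarrow> real^'m \<Rightarrow> ('i \<Rightarrow> real^'m) \<Rightarrow> real^'m \<Rightarrow> real" where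
  "market_cost D' c rho R P q p q' p' =
     liquidity_cost D' q' p p' + (\<Sum>i\<in>D'. risk_change c rho R P q p q' p' i)"

end

theory Submission
  imports Defs
begin

text \<open>
  For a Gaussian loss the entropic risk is mean plus \<open>r / 2\<close> times variance, so the risk of
  a position \<open>x\<close> is a quadratic polynomial in \<open>x\<close> and its minimiser at price \<open>p\<close> satisfies
  \<open>r\<^sub>i (cov\<^sub>i + \<Gamma> q\<^sub>i) = \<mu> - p\<close>, where \<open>\<mu>\<close> is the mean of \<open>P\<close>. In the sum of the changes of risk
  the price terms cancel against the liquidity cost because \<open>q\<close> and \<open>q'\<close> have the same sum
  \<open>- q\<^sub>d\<close> over \<open>D'\<close>. Without new participants, adding up the first order conditions over \<open>D\<close> and
  over \<open>D'\<close> gives \<open>\<mu> - p\<close> and \<open>\<mu> - p'\<close> as combinations of \<open>cov\<close> and \<open>\<Gamma> q\<^sub>d\<close>.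
\<close>

section \<open>Gaussian random variables\<close>

text \<open>Completing the square: the factor \<open>exp (s * x)\<close> moves the mean to
  \<open>m + s * \<sigma>\<^sup>2\<close> and leaves a constant, so the value follows from the total
  mass 1 of the shifted density.\<close>

lemma has_bochner_integral_normal_density_exp:
  assumes "0 < \<sigma>"
  shows "has_bochner_integral lborel (\<lambda>x. normal_density m \<sigma> x * exp (s * x))
           (exp (s * m + s\<^sup>2 * \<sigma>\<^sup>2 / 2))"
proof -
  have square: "- (x - m)\<^sup>2 / (2 * \<sigma>\<^sup>2) + s * x =
      s * m + s\<^sup>2 * \<sigma>\<^sup>2 / 2 + - (x - (m + s * \<sigma>\<^sup>2))\<^sup>2 / (2 * \<sigma>\<^sup>2)" for x
    using assms by (simp add: field_simps power2_eq_square)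
  have "normal_density m \<sigma> x * exp (s * x) =
      normal_density (m + s * \<sigma>\<^sup>2) \<sigma> x * exp (s * m + s\<^sup>2 * \<sigma>\<^sup>2 / 2)" for x
    unfolding normal_density_def
    by (simp only: mult.assoc exp_add[symmetric] square) (simp add: add.commute)
  moreover have "has_bochner_integral lborel (normal_density (m + s * \<sigma>\<^sup>2) \<sigma>) 1"
    using assms by (simp add: has_bochner_integral_iff)
  ultimately show ?thesis
    using has_bochner_integral_mult_left[of "exp (s * m + s\<^sup>2 * \<sigma>\<^sup>2 / 2)" lborel
        "normal_density (m + s * \<sigma>\<^sup>2) \<sigma>" 1] by simp
qed

text \<open>Measurability is a separate conjunct because integrability of the square gives no
  control over the sign of \<open>X\<close>.\<close>

definition square_integrable :: "'a measure \<Rightarrow> ('a \<Rightarrow> real) \<Rightarrow> bool" where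
  "square_integrable M X \<longleftrightarrow> X \<in> borel_measurable M \<and> integrable M (\<lambda>\<omega>. (X \<omega>)\<^sup>2)"

context prob_space
begin

lemma AE_eq_of_distr_return:
  assumes [measurable]: "Y \<in> borel_measurable M" and "distr M borel Y = return borel (m :: real)"
  shows "AE \<omega> in M. Y \<omega> = m"
proof -
  have "AE y in distr M borel Y. y = m"
    unfolding assms(2) by (simp add: AE_return)
  then show ?thesis by (simp add: AE_distr_iff)
qed

lemma distributed_of_gaussian:
  assumes "Y \<in> borel_measurable M" and "distr M borel Y = gaussian_measure m v" and "v \<noteq> 0"
  shows "distributed M lborel Y (normal_density m (sqrt v))"
proof -
  have "distr M lborel Y = distr M borel Y" by (rule distr_cong) auto
  then show ?thesis
    using assms by (simp add: distributed_def gaussian_measure_def)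
qed

text \<open>If \<open>v = 0\<close>, \<open>Y\<close> is almost surely the constant
  \<open>m\<close>. Otherwise \<open>Y\<close> has a normal density, and every claim becomes an
  integral against it.\<close>

lemma gaussian_moments:
  assumes Y [measurable]: "Y \<in> borel_measurable M"
    and law: "distr M borel Y = gaussian_measure m v" and "0 \<le> v"
  shows gaussian_square_integrable: "square_integrable M Y"
    and gaussian_expectation: "expectation Y = m"
    and gaussian_variance: "variance Y = v"
    and gaussian_mgf: "expectation (\<lambda>\<omega>. exp (s * Y \<omega>)) = exp (s * m + s\<^sup>2 * v / 2)"
proof -
  have "square_integrable M Y \<and> expectation Y = m \<and> variance Y = v \<and>
      expectation (\<lambda>\<omega>. exp (s * Y \<omega>)) = exp (s * m + s\<^sup>2 * v / 2)"
  proof (cases "v = 0")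
    case True
    with law have ae: "AE \<omega> in M. Y \<omega> = m"
      by (intro AE_eq_of_distr_return) (auto simp: gaussian_measure_def)
    have "integrable M (\<lambda>\<omega>. (Y \<omega>)\<^sup>2) \<longleftrightarrow> integrable M (\<lambda>\<omega>. m\<^sup>2)"
      using ae by (intro integrable_cong_AE) auto
    moreover have mean: "expectation Y = expectation (\<lambda>\<omega>. m)"
      using ae by (intro integral_cong_AE) auto
    moreover have "variance Y = expectation (\<lambda>\<omega>. 0)"
      using ae mean by (intro integral_cong_AE) (auto simp: prob_space)
    moreover have "expectation (\<lambda>\<omega>. exp (s * Y \<omega>)) = expectation (\<lambda>\<omega>. exp (s * m))"
      using ae by (intro integral_cong_AE) auto
    ultimately show ?thesis
      using True by (simp add: square_integrable_def prob_space)
  next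
    case False
    with \<open>0 \<le> v\<close> have sd: "0 < sqrt v" by simp
    note D = distributed_of_gaussian[OF Y law False]
    have "integrable M (\<lambda>\<omega>. (Y \<omega> - m)\<^sup>2)"
      using distributed_integrable[OF D, of "\<lambda>x. (x - m)\<^sup>2"] integrable_normal_moment[OF sd, of m 2]
      by simp
    moreover have "integrable M Y"
      using distributed_integrable[OF D, of "\<lambda>x. x"] integrable_normal_moment_nz_1[OF sd, of m]
      by simp
    \<comment> \<open>The known moments are the centred second one and the first; the raw square is
      rebuilt from them.\<close>
    ultimately have "integrable M (\<lambda>\<omega>. (Y \<omega> - m)\<^sup>2 + 2 * m * Y \<omega> - m\<^sup>2)"
      by (intro Bochner_Integration.integrable_add Bochner_Integration.integrable_diff) auto
    moreover have "(\<lambda>\<omega>. (Y \<omega> - m)\<^sup>2 + 2 * m * Y \<omega> - m\<^sup>2) = (\<lambda>\<omega>. (Y \<omega>)\<^sup>2)"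
      by (simp add: power2_diff)
    ultimately have "square_integrable M Y"
      by (simp add: square_integrable_def)
    moreover have "expectation (\<lambda>\<omega>. exp (s * Y \<omega>)) = exp (s * m + s\<^sup>2 * v / 2)"
      using distributed_integral[OF D, of "\<lambda>x. exp (s * x)"] \<open>0 \<le> v\<close>
        has_bochner_integral_integral_eq[OF has_bochner_integral_normal_density_exp[OF sd, of m s]]
      by simp
    ultimately show ?thesis
      using normal_distributed_expectation[OF sd D] normal_distributed_variance[OF sd D] \<open>0 \<le> v\<close>
      by simp
  qed
  then show "square_integrable M Y" "expectation Y = m" "variance Y = v"
    "expectation (\<lambda>\<omega>. exp (s * Y \<omega>)) = exp (s * m + s\<^sup>2 * v / 2)" by auto
qed

text \<open>The shift \<open>a\<close> contributes only the factor \<open>exp (r * a)\<close>, and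
  the logarithm of the moment generating function at \<open>r\<close> is linear in mean and
  variance. Writing \<open>expectation Y\<close> and \<open>variance Y\<close> keeps the parameters
  of the law out of later formulas.\<close>

lemma entropic_risk_gaussian:
  assumes "Y \<in> borel_measurable M" and "distr M borel Y = gaussian_measure m v" and "0 \<le> v"
    and "r \<noteq> 0"
  shows "entropic_risk M r (\<lambda>\<omega>. a + Y \<omega>) = a + expectation Y + r / 2 * variance Y"
proof -
  have "expectation (\<lambda>\<omega>. exp (r * (a + Y \<omega>))) = exp (r * a) * exp (r * m + r\<^sup>2 * v / 2)"
    using gaussian_mgf[OF assms(1-3), of r] by (simp add: distrib_left exp_add)
  also have "\<dots> = exp (r * (a + m + r / 2 * v))"
    by (simp add: exp_add[symmetric] algebra_simps power2_eq_square)
  finally show ?thesis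
    using assms(4) gaussian_expectation[OF assms(1-3)] gaussian_variance[OF assms(1-3)]
    by (simp add: entropic_risk_def)
qed

end

section \<open>Covariances of square integrable random variables\<close>

context prob_space
begin

lemma square_integrable_integrable_mult:
  assumes "square_integrable M X" "square_integrable M Y"
  shows "integrable M (\<lambda>\<omega>. X \<omega> * Y \<omega>)"
proof (rule Bochner_Integration.integrable_bound)
  show "integrable M (\<lambda>\<omega>. (X \<omega>)\<^sup>2 + (Y \<omega>)\<^sup>2)"
    using assms by (simp add: square_integrable_def)
  show "(\<lambda>\<omega>. X \<omega> * Y \<omega>) \<in> borel_measurable M"
    using assms by (auto simp: square_integrable_def)
  have "\<bar>x * y\<bar> \<le> x\<^sup>2 + y\<^sup>2" for x y :: real
  proof -
    have "0 \<le> (x + y)\<^sup>2" "0 \<le> (x - y)\<^sup>2" "0 \<le> x\<^sup>2" "0 \<le> y\<^sup>2" by simp_all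
    then show ?thesis unfolding power2_sum power2_diff by (simp only: abs_le_iff) linarith
  qed
  then show "AE \<omega> in M. norm (X \<omega> * Y \<omega>) \<le> norm ((X \<omega>)\<^sup>2 + (Y \<omega>)\<^sup>2)"
    by (simp add: abs_of_nonneg)
qed

lemma square_integrable_integrable:
  "square_integrable M X \<Longrightarrow> integrable M X"
  by (simp add: square_integrable_def square_integrable_imp_integrable)

lemma square_integrable_const: "square_integrable M (\<lambda>\<omega>. a)"
  by (simp add: square_integrable_def)

lemma square_integrable_add:
  assumes "square_integrable M X" "square_integrable M Y"
  shows "square_integrable M (\<lambda>\<omega>. X \<omega> + Y \<omega>)"
  using assms square_integrable_integrable_mult[OF assms]
  by (auto simp: square_integrable_def power2_sum mult.assoc)

lemma square_integrable_mult_left: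
  "square_integrable M X \<Longrightarrow> square_integrable M (\<lambda>\<omega>. a * X \<omega>)"
  by (auto simp: square_integrable_def power_mult_distrib)

lemma square_integrable_sum:
  "(\<And>j. j \<in> A \<Longrightarrow> square_integrable M (X j)) \<Longrightarrow> square_integrable M (\<lambda>\<omega>. \<Sum>j\<in>A. X j \<omega>)"
  by (induction A rule: infinite_finite_induct)
    (auto intro: square_integrable_add square_integrable_const)

lemma square_integrable_inner:
  fixes P :: "'a \<Rightarrow> real^'m"
  assumes "\<And>j. square_integrable M (\<lambda>\<omega>. P \<omega> $ j)"
  shows "square_integrable M (\<lambda>\<omega>. x \<bullet> P \<omega>)"
  unfolding inner_vec_def inner_real_def
  by (intro square_integrable_sum square_integrable_mult_left assms)

lemma covariance_commute: "covariance M X Y = covariance M Y X"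
  by (simp add: covariance_def mult.commute)

lemma covariance_eq:
  assumes "square_integrable M X" "square_integrable M Y"
  shows "covariance M X Y = expectation (\<lambda>\<omega>. X \<omega> * Y \<omega>) - expectation X * expectation Y"
proof -
  note int = square_integrable_integrable_mult[OF assms]
    square_integrable_integrable[OF assms(1)] square_integrable_integrable[OF assms(2)]
  have "covariance M X Y = expectation (\<lambda>\<omega>. X \<omega> * Y \<omega> - X \<omega> * expectation Y -
      expectation X * Y \<omega> + expectation X * expectation Y)"
    by (simp add: covariance_def algebra_simps)
  also have "\<dots> = expectation (\<lambda>\<omega>. X \<omega> * Y \<omega>) - expectation X * expectation Y"
    using int by (simp add: prob_space)
  finally show ?thesis .
qed

text \<open>Linearity is established in the second argument; the first is reached through
  \<open>covariance_commute\<close>.\<close>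

lemma covariance_add_right:
  assumes "square_integrable M X" "square_integrable M Y" "square_integrable M Z"
  shows "covariance M X (\<lambda>\<omega>. Y \<omega> + Z \<omega>) = covariance M X Y + covariance M X Z"
  using assms by (simp add: covariance_eq square_integrable_add square_integrable_integrable
      square_integrable_integrable_mult distrib_left)

lemma covariance_mult_right:
  assumes "square_integrable M X" "square_integrable M Y"
  shows "covariance M X (\<lambda>\<omega>. a * Y \<omega>) = a * covariance M X Y"
  using assms by (simp add: covariance_eq square_integrable_mult_left mult.left_commute
      right_diff_distrib)

lemma covariance_const_right: "covariance M X (\<lambda>\<omega>. a) = 0"
  by (simp add: covariance_def prob_space)

lemma covariance_sum_right:
  assumes "square_integrable M X" "\<And>j. j \<in> A \<Longrightarrow> square_integrable M (Y j)"
  shows "covariance M X (\<lambda>\<omega>. \<Sum>j\<in>A. Y j \<omega>) = (\<Sum>j\<in>A. covariance M X (Y j))"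
  using assms
  by (induction A rule: infinite_finite_induct)
    (auto simp: covariance_const_right covariance_add_right square_integrable_sum)

lemma covariance_inner_right:
  fixes P :: "'a \<Rightarrow> real^'m"
  assumes "square_integrable M X" "\<And>j. square_integrable M (\<lambda>\<omega>. P \<omega> $ j)"
  shows "covariance M X (\<lambda>\<omega>. x \<bullet> P \<omega>) = x \<bullet> cov_vector M X P"
  using assms by (simp add: inner_vec_def cov_vector_def covariance_sum_right
      covariance_mult_right square_integrable_mult_left)

text \<open>By bilinearity. This is the source of \<open>cv c = G *v q d\<close>, the receivable of
  the CCP being a portfolio of \<open>P\<close> up to a constant.\<close>

lemma cov_vector_inner:
  fixes P :: "'a \<Rightarrow> real^'m"
  assumes "\<And>j. square_integrable M (\<lambda>\<omega>. P \<omega> $ j)"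
  shows "cov_vector M (\<lambda>\<omega>. x \<bullet> P \<omega>) P = cov_matrix M P *v x"
proof -
  have "covariance M (\<lambda>\<omega>. x \<bullet> P \<omega>) (\<lambda>\<omega>. P \<omega> $ j) = (cov_matrix M P *v x) $ j" for j
    using covariance_inner_right[OF assms[of j] assms, of x]
    by (subst covariance_commute)
      (simp add: inner_vec_def cov_vector_def cov_matrix_def matrix_vector_mult_def mult.commute)
  then show ?thesis by (simp add: cov_vector_def vec_eq_iff)
qed

lemma expectation_inner:
  fixes P :: "'a \<Rightarrow> real^'m"
  assumes "\<And>j. integrable M (\<lambda>\<omega>. P \<omega> $ j)"
  shows "expectation (\<lambda>\<omega>. x \<bullet> P \<omega>) = x \<bullet> (\<chi> j. expectation (\<lambda>\<omega>. P \<omega> $ j))"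
  using assms by (simp add: inner_vec_def)

end

lemma transpose_cov_matrix: "transpose (cov_matrix M P) = cov_matrix M P"
  by (simp add: transpose_def cov_matrix_def vec_eq_iff covariance_def mult.commute)

lemma inner_vec_cons: "vec_cons a x \<bullet> vec_cons b y = a * b + x \<bullet> y"
  by (simp add: inner_vec_def vec_cons_def UNIV_option_conv sum.reindex)


section \<open>The entropic risk of a position\<close>

text \<open>Every linear functional of the joint vector is univariate Gaussian; the coordinate
  directions pick out \<open>R\<close> and the components of \<open>P\<close>.\<close>

lemma gaussian_square_integrable_components:
  fixes R :: "'a \<Rightarrow> real" and P :: "'a \<Rightarrow> real^'m"
  assumes prob: "prob_space M" and gauss: "has_gaussian_law M (\<lambda>\<omega>. vec_cons (R \<omega>) (P \<omega>)) mu S"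
  shows "square_integrable M R" and "square_integrable M (\<lambda>\<omega>. P \<omega> $ j)"
proof -
  interpret prob_space M by (rule prob)
  have "square_integrable M (\<lambda>\<omega>. t \<bullet> vec_cons (R \<omega>) (P \<omega>))" for t
    using gauss unfolding has_gaussian_law_def
    by (intro gaussian_square_integrable[of _ "t \<bullet> mu" "t \<bullet> (S *v t)"]) auto
  from this[of "vec_cons 1 0"] this[of "vec_cons 0 (axis j 1)"]
  show "square_integrable M R" "square_integrable M (\<lambda>\<omega>. P \<omega> $ j)"
    by (simp_all add: inner_vec_cons inner_axis')
qed

text \<open>Apart from the constant \<open>x \<bullet> p\<close>, the loss is the functional of the
  joint vector in direction \<open>vec_cons (-1) (- x)\<close>, hence Gaussian. Bilinearity then
  expands its mean and variance in terms of \<open>R\<close> and \<open>P\<close>.\<close>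

lemma entropic_risk_position:
  fixes R :: "'a \<Rightarrow> real" and P :: "'a \<Rightarrow> real^'m"
  assumes prob: "prob_space M" and gauss: "has_gaussian_law M (\<lambda>\<omega>. vec_cons (R \<omega>) (P \<omega>)) mu S"
    and "r \<noteq> 0"
  shows "entropic_risk M r (\<lambda>\<omega>. - R \<omega> + x \<bullet> (p - P \<omega>)) =
    - prob_space.expectation M R + x \<bullet> (p - (\<chi> j. prob_space.expectation M (\<lambda>\<omega>. P \<omega> $ j))) +
    r / 2 * (covariance M R R + 2 * (x \<bullet> cov_vector M R P) + x \<bullet> (cov_matrix M P *v x))"
proof -
  interpret prob_space M by (rule prob)
  note sqR = gaussian_square_integrable_components(1)[OF prob gauss]
  note sqP = gaussian_square_integrable_components(2)[OF prob gauss]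
  note sqx = square_integrable_inner[OF sqP, of "- x"]
  note sqR' = square_integrable_mult_left[OF sqR, of "-1"]
  note sqY = square_integrable_add[OF sqR' sqx]
  define Y where "Y = (\<lambda>\<omega>. -1 * R \<omega> + - x \<bullet> P \<omega>)"
  let ?t = "vec_cons (-1) (- x) :: real^('m option)"
  have Y: "Y = (\<lambda>\<omega>. ?t \<bullet> vec_cons (R \<omega>) (P \<omega>))"
    by (simp add: Y_def inner_vec_cons)
  have "Y \<in> borel_measurable M" "distr M borel Y = gaussian_measure (?t \<bullet> mu) (?t \<bullet> (S *v ?t))"
    "0 \<le> ?t \<bullet> (S *v ?t)"
    using gauss unfolding has_gaussian_law_def Y by auto
  from entropic_risk_gaussian[OF this \<open>r \<noteq> 0\<close>, of "x \<bullet> p"]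
  have risk: "entropic_risk M r (\<lambda>\<omega>. - R \<omega> + x \<bullet> (p - P \<omega>)) =
      x \<bullet> p + expectation Y + r / 2 * covariance M Y Y"
    by (simp add: Y_def inner_diff_right covariance_def power2_eq_square algebra_simps)
  have mean: "expectation Y = - expectation R - x \<bullet> (\<chi> j. expectation (\<lambda>\<omega>. P \<omega> $ j))"
    unfolding Y_def
    using square_integrable_integrable[OF sqR'] square_integrable_integrable[OF sqx]
      expectation_inner[OF square_integrable_integrable[OF sqP], of "- x"]
    by simp
  have RY: "covariance M R Y = - covariance M R R - x \<bullet> cov_vector M R P"
    unfolding Y_def
    by (simp only: covariance_add_right[OF sqR sqR' sqx] covariance_mult_right[OF sqR sqR]
        covariance_inner_right[OF sqR sqP]) simp
  have xY: "covariance M (\<lambda>\<omega>. - x \<bullet> P \<omega>) Y = x \<bullet> cov_vector M R P + x \<bullet> (cov_matrix M P *v x)"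
    unfolding Y_def
    by (simp only: covariance_add_right[OF sqx sqR' sqx] covariance_mult_right[OF sqx sqR]
        covariance_commute[of "\<lambda>\<omega>. - x \<bullet> P \<omega>" R] covariance_inner_right[OF sqR sqP]
        covariance_inner_right[OF sqx sqP] cov_vector_inner[OF sqP])
      (simp add: matrix_vector_mult_scaleR[of _ "-1", simplified])
  \<comment> \<open>The second copy of \<open>Y\<close> is split first; symmetry then moves the
    remaining copy to the right, where \<open>RY\<close> and \<open>xY\<close> apply.\<close>
  have "covariance M Y Y = covariance M Y (\<lambda>\<omega>. -1 * R \<omega>) + covariance M Y (\<lambda>\<omega>. - x \<bullet> P \<omega>)"
    using covariance_add_right[OF sqY sqR' sqx] unfolding Y_def[symmetric] .
  also have "\<dots> = - covariance M R Y + covariance M (\<lambda>\<omega>. - x \<bullet> P \<omega>) Y"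
    using covariance_mult_right[OF sqY sqR, of "-1"] unfolding Y_def[symmetric]
    by (simp only: covariance_commute[of Y R] covariance_commute[of Y "\<lambda>\<omega>. - x \<bullet> P \<omega>"])
  finally have "covariance M Y Y = - covariance M R Y + covariance M (\<lambda>\<omega>. - x \<bullet> P \<omega>) Y" .
  then show ?thesis
    unfolding risk mean RY xY by (simp add: inner_diff_right algebra_simps)
qed

section \<open>First order conditions\<close>

lemma linear_coeff_eq_zero:
  fixes a b :: real
  assumes "\<And>t. 0 \<le> t * a + t\<^sup>2 * b"
  shows "a = 0"
proof (rule ccontr)
  assume "a \<noteq> 0"
  \<comment> \<open>\<open>B\<close> is a positive upper bound of \<open>b\<close>, and
    \<open>t = - a / (2 * B)\<close> minimises \<open>t * a + t\<^sup>2 * B\<close>, with the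
    negative minimum \<open>- (a\<^sup>2 / (4 * B))\<close>.\<close>
  define B where "B = \<bar>b\<bar> + 1"
  have "0 < B" "b \<le> B" by (auto simp: B_def)
  have "0 \<le> (- a / (2 * B)) * a + (- a / (2 * B))\<^sup>2 * b" by (rule assms)
  also have "\<dots> \<le> (- a / (2 * B)) * a + (- a / (2 * B))\<^sup>2 * B"
    using \<open>b \<le> B\<close> by (intro add_left_mono mult_left_mono) auto
  also have "\<dots> = - (a\<^sup>2 / (4 * B))"
    using \<open>0 < B\<close> by (simp add: field_simps power2_eq_square)
  also have "\<dots> < 0" using \<open>0 < B\<close> \<open>a \<noteq> 0\<close> by simp
  finally show False by simp
qed

lemma symmetric_matrix_inner:
  fixes G :: "real^'m^'m"
  assumes "transpose G = G"
  shows "x \<bullet> (G *v y) = y \<bullet> (G *v x)"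
  using assms by (metis dot_lmul_matrix inner_commute transpose_matrix_vector)

text \<open>Moving from \<open>q\<close> in the direction of the gradient \<open>h\<close> itself
  changes the value by a polynomial in \<open>t\<close> with linear coefficient
  \<open>h \<bullet> h\<close>, which minimality forces to vanish.\<close>

lemma quadratic_minimizer_stationary:
  fixes G :: "real^'m^'m"
  assumes sym: "transpose G = G"
    and min: "\<And>x. b \<bullet> q + k * (q \<bullet> (G *v q)) \<le> b \<bullet> x + k * (x \<bullet> (G *v x))"
  shows "b + (2 * k) *\<^sub>R (G *v q) = 0"
proof -
  define h where "h = b + (2 * k) *\<^sub>R (G *v q)"
  have "0 \<le> t * (h \<bullet> h) + t\<^sup>2 * (k * (h \<bullet> (G *v h)))" for t
  proof -
    \<comment> \<open>Only one factor \<open>h\<close> is expanded, to match the linear term in the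
      expansion at \<open>q + t *\<^sub>R h\<close>.\<close>
    have "t * (h \<bullet> h) = t * (b \<bullet> h + 2 * k * (h \<bullet> (G *v q)))"
      by (subst (2) h_def) (simp add: inner_add_right inner_commute)
    then show ?thesis
      using min[of "q + t *\<^sub>R h"] symmetric_matrix_inner[OF sym, of q h]
      by (simp add: matrix_vector_right_distrib matrix_vector_mult_scaleR inner_add_left
          inner_add_right algebra_simps power2_eq_square)
  qed
  then have "h \<bullet> h = 0" by (rule linear_coeff_eq_zero)
  then show ?thesis by (simp add: h_def)
qed

section \<open>Market cost\<close>

text \<open>
  Here \<open>a\<close> and \<open>b\<close> stand for \<open>\<mu> - p\<close> and \<open>\<mu> - p'\<close>, so that \<open>q d \<bullet> a\<close> is \<open>E[R\<^sub>c]\<close>. Put \<open>z = \<Gamma>\<^sup>-\<^sup>1 a\<close> and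
  \<open>u = \<Gamma>\<^sup>-\<^sup>1 b\<close>. A survivor trades \<open>(u - z) / r\<^sub>i\<close>, and its summand telescopes to
  \<open>(u \<bullet> b - z \<bullet> a) / (2 r\<^sub>i)\<close> by the symmetry of \<open>\<Gamma>\<close>.
\<close>

lemma market_cost_closed_form:
  fixes G :: "real^'m^'m" and q q' cv :: "'i \<Rightarrow> real^'m" and a b cov :: "real^'m"
    and r :: "'i \<Rightarrow> real"
  assumes sym: "transpose G = G" and inv: "invertible G"
    and fin: "finite D" and d: "d \<in> D" and c: "c \<notin> D" and D': "D' = (D - {d}) \<union> {c}"
    and r_pos: "\<And>i. i \<in> D \<union> D' \<Longrightarrow> 0 < r i"
    and pre: "\<And>i. i \<in> D \<Longrightarrow> G *v q i = (1 / r i) *\<^sub>R a - cv i" and q_sum: "(\<Sum>i\<in>D. q i) = 0"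
    and post: "\<And>i. i \<in> D' \<Longrightarrow> G *v q' i = (1 / r i) *\<^sub>R b - cv i"
    and q'_sum: "(\<Sum>i\<in>D'. q' i) = - q d"
    and q_c: "q c = 0" and cv_c: "cv c = G *v q d"
    and cov_def: "cov = (\<Sum>i\<in>D. cv i)"
    and r_pre_def: "r_pre = inverse (\<Sum>i\<in>D. 1 / r i)"
    and r_post_def: "r_post = inverse (\<Sum>i\<in>D'. 1 / r i)"
  shows "(\<Sum>i\<in>D'. r i * ((q' i - q i) \<bullet> (cv i + G *v (q i + (1/2) *\<^sub>R (q' i - q i))))) +
      r c / 2 * (q d \<bullet> (G *v q d)) - q d \<bullet> a =
      r_pre\<^sup>2 * (r_post - r c) / (2 * (r c)\<^sup>2) * (cov \<bullet> (matrix_inv G *v cov)) +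
      r_post / 2 * (q d \<bullet> (G *v q d)) - r_post * r_pre / r c * (q d \<bullet> cov)"
proof -
  let ?J = "matrix_inv G"
  \<comment> \<open>The survivors' share of both sums of \<open>1 / r i\<close>: adding
    \<open>1 / r d\<close> gives the inverse of \<open>r_pre\<close>, adding \<open>1 / r c\<close>
    that of \<open>r_post\<close>.\<close>
  define k where "k = (\<Sum>i\<in>D - {d}. 1 / r i)"
  have rd: "0 < r d" and rc: "0 < r c" using r_pos d D' by auto
  have "0 \<le> k" unfolding k_def using r_pos by (intro sum_nonneg) (auto simp: less_imp_le)
  have GJ: "G *v (?J *v x) = x" and JG: "?J *v (G *v x) = x" for x
    using someI_ex[OF inv[unfolded invertible_def]]
    by (simp_all add: matrix_vector_mul_assoc matrix_inv_def)
  note G_simps = matrix_vector_right_distrib matrix_vector_mult_diff_distrib matrix_vector_mult_scaleR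
  define w where "w = ?J *v cov"
  have Gw: "G *v w = cov" by (simp add: w_def GJ)
  have pre_inv: "inverse r_pre = k + 1 / r d"
    using fin d by (simp add: r_pre_def k_def sum.remove)
  have post_inv: "inverse r_post = k + 1 / r c"
    using fin c by (simp add: r_post_def k_def D')
  have r_pre: "r_pre > 0" and r_post: "r_post > 0"
    using pre_inv post_inv \<open>0 \<le> k\<close> rd rc by (metis add_nonneg_pos inverse_positive_iff_positive zero_less_divide_1_iff)+
  have lin_sum: "G *v (\<Sum>i\<in>A. f i) = (\<Sum>i\<in>A. G *v f i)" for A and f :: "'i \<Rightarrow> real^'m"
    by (rule linear_sum) simp
  \<comment> \<open>Summing the first order conditions over \<open>D\<close>, where positions clear
    to zero, determines \<open>a\<close>.\<close>
  have "0 = (\<Sum>i\<in>D. (1 / r i) *\<^sub>R a - cv i)"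
    using lin_sum[of q D] unfolding q_sum by (simp add: pre)
  also have "\<dots> = inverse r_pre *\<^sub>R a - cov"
    by (simp add: sum_subtractf r_pre_def cov_def scaleR_left.sum)
  finally have "inverse r_pre *\<^sub>R a = cov" by simp
  then have a_eq: "a = r_pre *\<^sub>R cov" using r_pre by auto
  have "- (G *v q d) = (\<Sum>i\<in>D'. (1 / r i) *\<^sub>R b - cv i)"
    using lin_sum[of q' D'] unfolding q'_sum
    by (simp add: post matrix_vector_mult_scaleR[of _ "-1", simplified])
  also have "\<dots> = inverse r_post *\<^sub>R b - (\<Sum>i\<in>D'. cv i)"
    by (simp add: sum_subtractf r_post_def scaleR_left.sum)
  also have "(\<Sum>i\<in>D'. cv i) = cov - cv d + G *v q d"
    using fin c d by (simp add: D' cov_def cv_c sum.remove[of D d])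
  \<comment> \<open>The term \<open>G *v q d\<close> from market clearing cancels against the
    covariance vector of the CCP.\<close>
  finally have "inverse r_post *\<^sub>R b = cov - cv d" by (simp add: algebra_simps)
  \<comment> \<open>The defaulter's own condition before the default eliminates \<open>cv d\<close>,
    so only \<open>cov\<close> and \<open>q d\<close> remain.\<close>
  also have "cv d = (r_pre / r d) *\<^sub>R cov - G *v q d"
    using pre[OF d] by (simp add: a_eq)
  also have "r_pre / r d = 1 - r_pre * k"
    using arg_cong[OF pre_inv, of "\<lambda>x. r_pre * x"] r_pre by (simp add: algebra_simps)
  finally have "inverse r_post *\<^sub>R b = G *v ((r_pre * k) *\<^sub>R w + q d)"
    by (simp add: G_simps Gw algebra_simps)
  then have b_eq: "b = r_post *\<^sub>R (G *v ((r_pre * k) *\<^sub>R w + q d))"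
    using r_post by (metis field_class.field_inverse_zero less_irrefl right_inverse scaleR_one scaleR_scaleR)
  define z where "z = r_pre *\<^sub>R w"
  define u where "u = r_post *\<^sub>R ((r_pre * k) *\<^sub>R w + q d)"
  have Gz: "G *v z = a" and Gu: "G *v u = b"
    by (simp_all add: z_def u_def G_simps Gw a_eq b_eq)
  \<comment> \<open>The cross terms of \<open>(u - z) \<bullet> (a + b)\<close> cancel by this
    identity.\<close>
  have zb: "z \<bullet> b = u \<bullet> a"
    unfolding Gz[symmetric] Gu[symmetric] by (rule symmetric_matrix_inner[OF sym])
  have survivor: "r i * ((q' i - q i) \<bullet> (cv i + G *v (q i + (1/2) *\<^sub>R (q' i - q i)))) =
      1 / r i * ((u \<bullet> b - z \<bullet> a) / 2)" if "i \<in> D - {d}" for i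
  proof -
    have ri: "0 < r i" using that r_pos by auto
    have G_diff: "G *v (q' i - q i) = (1 / r i) *\<^sub>R (b - a)"
      using that by (simp add: matrix_vector_mult_diff_distrib D' pre post scaleR_diff_right)
    have "q' i - q i = ?J *v (G *v (q' i - q i))" by (simp add: JG)
    also have "\<dots> = (1 / r i) *\<^sub>R (u - z)"
      unfolding G_diff Gz[symmetric] Gu[symmetric] by (simp add: G_simps JG)
    finally have diff: "q' i - q i = (1 / r i) *\<^sub>R (u - z)" .
    \<comment> \<open>At the midpoint of the old and new positions the bracket is the average of the
      two first order conditions.\<close>
    have "cv i + G *v (q i + (1/2) *\<^sub>R (q' i - q i)) = cv i + G *v q i + (1/2) *\<^sub>R (G *v (q' i - q i))"
      by (simp only: G_simps add.assoc)
    also have "\<dots> = (1 / (2 * r i)) *\<^sub>R (a + b)"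
      using that ri unfolding G_diff by (simp add: pre vec_eq_iff field_simps)
    finally show ?thesis
      unfolding diff using ri zb
      by (simp add: inner_diff_left inner_add_right field_simps power2_eq_square)
  qed
  have Gqc: "G *v q' c = (1 / r c) *\<^sub>R b - G *v q d"
    using post[of c] by (simp add: D' cv_c)
  have "q' c = ?J *v (G *v q' c)" by (simp add: JG)
  also have "\<dots> = (1 / r c) *\<^sub>R u - q d"
    unfolding Gqc Gu[symmetric] by (simp add: G_simps JG)
  finally have qc: "q' c = (1 / r c) *\<^sub>R u - q d" .
  have ub: "u \<bullet> (G *v q d) = q d \<bullet> b"
    unfolding Gu[symmetric] by (rule symmetric_matrix_inner[OF sym])
  have "cv c + G *v (q c + (1/2) *\<^sub>R (q' c - q c)) = G *v q d + (1/2) *\<^sub>R (G *v q' c)"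
    by (simp only: q_c cv_c diff_zero add_0 matrix_vector_mult_scaleR)
  also have "\<dots> = (1/2) *\<^sub>R (G *v q d) + (1 / (2 * r c)) *\<^sub>R b"
    unfolding Gqc using rc by (simp add: vec_eq_iff field_simps)
  \<comment> \<open>The last term will cancel the variance term
    \<open>r c / 2 * (q d \<bullet> (G *v q d))\<close> of the goal.\<close>
  finally have ccp: "r c * ((q' c - q c) \<bullet> (cv c + G *v (q c + (1/2) *\<^sub>R (q' c - q c)))) =
      (u \<bullet> b) / (2 * r c) - r c / 2 * (q d \<bullet> (G *v q d))"
    using rc by (simp add: q_c qc ub inner_diff_left inner_add_right field_simps)
  have "sum f D' = sum f (D - {d}) + f c" for f :: "'i \<Rightarrow> real"
    using fin c by (simp add: D')
  then have total: "(\<Sum>i\<in>D'. r i * ((q' i - q i) \<bullet> (cv i + G *v (q i + (1/2) *\<^sub>R (q' i - q i))))) =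
      k * ((u \<bullet> b - z \<bullet> a) / 2) + ((u \<bullet> b) / (2 * r c) - r c / 2 * (q d \<bullet> (G *v q d)))"
    by (simp only: survivor ccp k_def sum_distrib_right cong: sum.cong)
  \<comment> \<open>All vectors now enter through these three scalars, so the claim becomes an
    identity of rational functions.\<close>
  define C Q X where "C = cov \<bullet> (?J *v cov)" and "Q = q d \<bullet> (G *v q d)" and "X = q d \<bullet> cov"
  note CQX = C_def[symmetric] Q_def[symmetric] X_def[symmetric]
  have wC: "w \<bullet> cov = C" by (simp add: C_def w_def inner_commute)
  have "w \<bullet> (G *v q d) = X"
    using symmetric_matrix_inner[OF sym, of w "q d"] by (simp add: Gw X_def)
  then have uu: "u \<bullet> b = r_post\<^sup>2 * ((r_pre * k)\<^sup>2 * C + 2 * (r_pre * k) * X + Q)"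
    unfolding u_def b_eq wC[symmetric] Q_def X_def
    by (simp add: G_simps Gw inner_add_left inner_add_right algebra_simps power2_eq_square)
  have zz: "z \<bullet> a = r_pre\<^sup>2 * C"
    by (simp add: z_def a_eq wC power2_eq_square)
  have qa: "q d \<bullet> a = r_pre * X" by (simp add: a_eq X_def)
  \<comment> \<open>Eliminating \<open>k\<close> leaves \<open>r_pre\<close>, \<open>r_post\<close>
    and \<open>r c\<close> as the coefficients, as in the goal.\<close>
  have k_eq: "k = 1 / r_post - 1 / r c" using post_inv by (simp add: inverse_eq_divide)
  show ?thesis
    unfolding total uu zz qa CQX k_eq using r_post rc by (simp add: field_simps power2_eq_square)
qed

section \<open>Liquidity and market cost from the equilibrium conditions\<close>

theorem proposition4p2:
  fixes M :: "'a measure"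
    and D D' :: "'i set" and c d :: 'i
    and R :: "'i \<Rightarrow> 'a \<Rightarrow> real" and P :: "'a \<Rightarrow> real^'m"
    and mu :: "'i \<Rightarrow> real^('m option)" and Gam :: "'i \<Rightarrow> real^('m option)^('m option)"
    and rho :: "'i \<Rightarrow> ('a \<Rightarrow> real) \<Rightarrow> real" and r :: "'i \<Rightarrow> real"
    and q q' :: "'i \<Rightarrow> real^'m" and p p' :: "real^'m"
    and G :: "real^'m^'m" and cv :: "'i \<Rightarrow> real^'m" and cov :: "real^'m"
    and r_pre r_post :: real
  assumes prob: "prob_space M"
    and fin: "finite D" "finite D'"
    and members: "d \<in> D" "c \<notin> D" "c \<in> D'" "d \<notin> D'" "D - {d} \<subseteq> D'"
    and gauss: "\<And>i. i \<in> D \<union> D' \<Longrightarrow>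
      has_gaussian_law M (\<lambda>\<omega>. vec_cons (R i \<omega>) (P \<omega>)) (mu i) (Gam i)"
    and G_def: "G = cov_matrix M P"
    and G_inv: "invertible G"
    and r_pos: "\<And>i. i \<in> D \<union> D' \<Longrightarrow> 0 < r i"
    and entropic: "\<And>i. i \<in> D \<union> D' \<Longrightarrow> rho i = entropic_risk M (r i)"
    and pre: "radner_equilibrium D rho R P q p"
    and q_new: "\<And>i. i \<in> D' - D \<Longrightarrow> q i = 0"
    and R_ccp: "R c = (\<lambda>\<omega>. q d \<bullet> (P \<omega> - p))"
    and post: "post_default_equilibrium D' rho R P q q' p'"
    and cv_def: "cv = (\<lambda>i. cov_vector M (R i) P)"
    and cov_def: "cov = (\<Sum>i\<in>D. cv i)"
    and r_pre_def: "r_pre = inverse (\<Sum>i\<in>D. 1 / r i)"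
    and r_post_def: "r_post = inverse (\<Sum>i\<in>D'. 1 / r i)"
  shows "liquidity_cost D' q' p p' = - (q d \<bullet> (p - p')) \<and>
    market_cost D' c rho R P q p q' p' =
      (\<Sum>i\<in>D'. r i * ((q' i - q i) \<bullet> (cv i + G *v (q i + (1/2) *\<^sub>R (q' i - q i))))) +
      (r c * prob_space.variance M (R c) / 2 - prob_space.expectation M (R c)) \<and>
    (D' = (D - {d}) \<union> {c} \<longrightarrow>
      market_cost D' c rho R P q p q' p' =
      r_pre\<^sup>2 * (r_post - r c) / (2 * (r c)\<^sup>2) * (cov \<bullet> (matrix_inv G *v cov)) +
      r_post / 2 * (q d \<bullet> (G *v q d)) -
      r_post * r_pre / r c * (q d \<bullet> cov))"
proof -
  interpret prob_space M by (rule prob)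
  define \<mu> where "\<mu> = (\<chi> j. expectation (\<lambda>\<omega>. P \<omega> $ j))"
  have sym: "transpose G = G" by (simp add: G_def transpose_cov_matrix)
  note gauss_c = gauss[of c, OF UnI2[OF members(3)]]
  note sqP = gaussian_square_integrable_components(2)[OF prob gauss_c]
  have risk: "rho i (\<lambda>\<omega>. - R i \<omega> + x \<bullet> (s - P \<omega>)) = - expectation (R i) + x \<bullet> (s - \<mu>) +
      r i / 2 * (covariance M (R i) (R i) + 2 * (x \<bullet> cv i) + x \<bullet> (G *v x))"
    if "i \<in> D \<union> D'" for i x s
    using entropic_risk_position[OF prob gauss[OF that], of "r i" x s] r_pos[OF that]
    by (simp add: entropic[OF that] cv_def G_def \<mu>_def)
  \<comment> \<open>The price \<open>s\<close> is arbitrary, so this serves both \<open>p\<close>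
    with \<open>q i\<close> on \<open>D\<close> and \<open>p'\<close> with \<open>q' i\<close> on
    \<open>D'\<close>.\<close>
  have stationary: "G *v y = (1 / r i) *\<^sub>R (\<mu> - s) - cv i"
    if "i \<in> D \<union> D'" and opt: "optimal_position (rho i) (R i) P s y" for i y s
  proof -
    have "(s - \<mu> + r i *\<^sub>R cv i) \<bullet> y + r i / 2 * (y \<bullet> (G *v y)) \<le>
        (s - \<mu> + r i *\<^sub>R cv i) \<bullet> x + r i / 2 * (x \<bullet> (G *v x))" for x
      using opt unfolding optimal_position_def risk[OF that(1)]
      by (auto simp: inner_add_left inner_commute algebra_simps dest!: spec[of _ x])
    then have "s - \<mu> + r i *\<^sub>R cv i + r i *\<^sub>R (G *v y) = 0"
      using quadratic_minimizer_stationary[OF sym, of "s - \<mu> + r i *\<^sub>R cv i" y "r i / 2"] by simp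
    then have "r i *\<^sub>R (G *v y) = \<mu> - s - r i *\<^sub>R cv i"
      by (simp add: algebra_simps add_eq_0_iff)
    then have "(1 / r i) *\<^sub>R (r i *\<^sub>R (G *v y)) = (1 / r i) *\<^sub>R (\<mu> - s) - (1 / r i) *\<^sub>R (r i *\<^sub>R cv i)"
      by (simp only: scaleR_diff_right)
    then show ?thesis using r_pos[OF that(1)] by simp
  qed
  have q_c: "q c = 0" using members by (intro q_new) auto
  have q_sum: "(\<Sum>i\<in>D. q i) = 0" using pre by (simp add: radner_equilibrium_def)
  have old_sum: "(\<Sum>i\<in>D'. q i) = - q d"
  proof -
    \<comment> \<open>New participants and the CCP start from zero, so only the survivors
      contribute: the cleared total over \<open>D\<close> without \<open>q d\<close>.\<close>
    have "(\<Sum>i\<in>D'. q i) = (\<Sum>i\<in>D - {d}. q i)"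
      using fin members q_new by (intro sum.mono_neutral_right) auto
    then show ?thesis using q_sum fin members by (simp add: sum_diff1)
  qed
  have new_sum: "(\<Sum>i\<in>D'. q' i) = - q d"
    using post old_sum
    by (simp add: post_default_equilibrium_def sum_subtractf eq_neg_iff_add_eq_0)
  have liquidity: "liquidity_cost D' q' p p' = - (q d \<bullet> (p - p'))"
    using new_sum by (simp add: liquidity_cost_def flip: inner_sum_left)
  have R_c: "R c = (\<lambda>\<omega>. q d \<bullet> P \<omega> + - (q d \<bullet> p))"
    by (simp add: R_ccp inner_diff_right)
  note sqPc = square_integrable_inner[OF sqP, of "q d"]
  have mean_c: "expectation (R c) = q d \<bullet> (\<mu> - p)"
    unfolding R_c using square_integrable_integrable[OF sqPc]
      expectation_inner[OF square_integrable_integrable[OF sqP], of "q d"]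
    by (simp add: \<mu>_def prob_space inner_diff_right)
  have cov_c: "covariance M (R c) X = covariance M (\<lambda>\<omega>. q d \<bullet> P \<omega>) X" for X
    unfolding R_c covariance_def using square_integrable_integrable[OF sqPc]
    by (simp add: prob_space)
  have cv_c: "cv c = G *v q d"
    using cov_vector_inner[OF sqP, of "q d"] by (simp add: cv_def G_def cov_vector_def cov_c)
  \<comment> \<open>\<open>cov_c\<close> drops the constant in the first argument only; swapping the
    arguments lets it act on the other copy of \<open>R c\<close>.\<close>
  have var_c: "covariance M (R c) (R c) = q d \<bullet> (G *v q d)"
    unfolding cov_c
    by (subst covariance_commute, unfold cov_c)
      (simp add: covariance_inner_right[OF sqPc sqP] cov_vector_inner[OF sqP] G_def)
  have variance_c: "variance (R c) = covariance M (R c) (R c)"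
    by (simp add: covariance_def power2_eq_square)
  let ?T = "\<lambda>i. r i * ((q' i - q i) \<bullet> (cv i + G *v (q i + (1/2) *\<^sub>R (q' i - q i))))"
  let ?K = "r c * variance (R c) / 2 - expectation (R c)"
  have change: "risk_change c rho R P q p q' p' i =
      q' i \<bullet> (p' - \<mu>) - q i \<bullet> (p - \<mu>) + ?T i + (if i = c then ?K else 0)" if "i \<in> D'" for i
  proof -
    have i: "i \<in> D \<union> D'" using that by simp
    \<comment> \<open>The midpoint rule is exact for quadratics: the increment equals the gradient
      at the midpoint paired with the change of position.\<close>
    have quad: "?T i = r i / 2 * (2 * (q' i \<bullet> cv i) + q' i \<bullet> (G *v q' i)) -
        r i / 2 * (2 * (q i \<bullet> cv i) + q i \<bullet> (G *v q i))"
      using symmetric_matrix_inner[OF sym, of "q' i" "q i"]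
      by (simp add: matrix_vector_right_distrib matrix_vector_mult_diff_distrib
          matrix_vector_mult_scaleR inner_add_right inner_diff_left inner_diff_right field_simps)
    show ?thesis
    proof (cases "i = c")
      case True
      \<comment> \<open>The CCP enters with no position and zero receivable, so its prior risk is 0
        and the mean and variance of \<open>R c\<close> survive as \<open>?K\<close>.\<close>
      have "rho c (\<lambda>\<omega>. 0) = 0"
        using entropic[of c] members(3) by (simp add: entropic_risk_def prob_space)
      then show ?thesis
        using quad[unfolded True] unfolding risk_change_def unfolding risk[OF i] unfolding True
        by (simp add: q_c variance_c algebra_simps)
    next
      \<comment> \<open>The receivable is the same before and after, so its mean and variance cancel
        in the difference.\<close>
      case False
      then have "rho i (\<lambda>\<omega>. - (of_bool (i \<noteq> c) * R i \<omega>) + q i \<bullet> (p - P \<omega>)) =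
          rho i (\<lambda>\<omega>. - R i \<omega> + q i \<bullet> (p - P \<omega>))" by simp
      with False show ?thesis
        unfolding risk_change_def quad by (simp only: risk[OF i]) (simp add: algebra_simps)
    qed
  qed
  have "(\<Sum>i\<in>D'. risk_change c rho R P q p q' p' i) =
      (\<Sum>i\<in>D'. q' i) \<bullet> (p' - \<mu>) - (\<Sum>i\<in>D'. q i) \<bullet> (p - \<mu>) + (\<Sum>i\<in>D'. ?T i) + ?K"
    using fin members(3)
    by (simp only: change sum.distrib sum_subtractf inner_sum_left sum.delta if_True cong: sum.cong)
  \<comment> \<open>Both position sums equal \<open>- q d\<close>, so the price terms add up to
    \<open>q d \<bullet> (p - p')\<close>, the negative of the liquidity cost.\<close>
  then have market: "market_cost D' c rho R P q p q' p' = (\<Sum>i\<in>D'. ?T i) + ?K"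
    unfolding market_cost_def liquidity old_sum new_sum by (simp add: inner_diff_right)
  have "market_cost D' c rho R P q p q' p' =
      r_pre\<^sup>2 * (r_post - r c) / (2 * (r c)\<^sup>2) * (cov \<bullet> (matrix_inv G *v cov)) +
      r_post / 2 * (q d \<bullet> (G *v q d)) - r_post * r_pre / r c * (q d \<bullet> cov)"
    if D': "D' = (D - {d}) \<union> {c}"
  proof -
    have pre': "G *v q i = (1 / r i) *\<^sub>R (\<mu> - p) - cv i" if "i \<in> D" for i
      using pre that by (intro stationary) (auto simp: radner_equilibrium_def)
    have post': "G *v q' i = (1 / r i) *\<^sub>R (\<mu> - p') - cv i" if "i \<in> D'" for i
      using post that by (intro stationary) (auto simp: post_default_equilibrium_def)
    have "(\<Sum>i\<in>D'. ?T i) + ?K = (\<Sum>i\<in>D'. ?T i) + r c / 2 * (q d \<bullet> (G *v q d)) - q d \<bullet> (\<mu> - p)"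
      unfolding variance_c unfolding var_c mean_c by simp
    then show ?thesis
      unfolding market
      using market_cost_closed_form[OF sym G_inv fin(1) members(1,2) D' r_pos pre' q_sum post'
          new_sum q_c cv_c cov_def r_pre_def r_post_def]
      by simp
  qed
  with liquidity market show ?thesis by blast
qed

end
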